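(* The family of metric spaces $(\mathbb N^n,d_{\mathrm{Ham}})_{n\ge1}$, where $d_{\mathrm{Ham}}$ is the Hamming metric, is $\Psi$-dominated with respect to the counting measure $\mu$ on $\mathbb N$.
   Context: The Hamming metric on $\mathbb N^n$ is $d_{\mathrm{Ham}}(x,y)=\#\{i: x_i\ne y_i\}$. For a metric space $(\mathcal X,\rho)$ with $\operatorname{diam}_\rho(\mathcal X)=\sup_{x,y}\rho(x,y)$, $\operatorname{Lip}(\mathcal X,\rho)$ is the set of $g:\mathcal X\to[0,\operatorname{diam}_\rho(\mathcal X)]$ with $|g(x)-g(y)|\le\rho(x,y)$ for all $x,y$. Let $(z)_+=\max(z,0)$ and let $\mu$ be a positive Borel measure on $\mathcal S$. For $f\in L_1(\mathcal S^n,\mu^n)$ put $(\pi f)(x_2,\dots,x_n)=\int_{\mathcal S}f(x_1,\dots,x_n)\,d\mu(x_1)$. Define $\Psi_0=0$ and $\Psi_n(f)=\int_{\mathcal S^n}(f)_+\,d\mu^n+\Psi_{n-1}(\pi f)$ for $n\ge1$. A family $(\mathcal S^n,\rho_n)_{n\ge1}$ of metric spaces is $\Psi$-dominated with respect to $\mu$ if (i) for all $n$, all $1\le i\le n$ and all $x,y\in\mathcal S^n$ with $x_i=y_i$, $\rho_n(x,y)=\rho_{n-1}(x',y')$, where $x',y'\in\mathcal S^{n-1}$ are obtained by deleting the $i$th coordinate (for $n=1$ this is void, both sides being $0$); (ii) for each $n$, $\mu^n=\mu\otimes\cdots\otimes\mu$ is a positive product measure on the Borel $\sigma$-algebra induced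 by $\rho_n$; and (iii) $\sup_{g\in\operatorname{Lip}(\mathcal S^n,\rho_n)}\int_{\mathcal S^n}fg\,d\mu^n\le\Psi_n(f)$ for every $n\ge1$ and every $f\in L_1(\mathcal S^n,\mu^n)$. *)

theory Defs
  imports "HOL-Analysis.Analysis"
begin

(* Points of S^n are extensional functions on {..<n}; the coordinates 1,...,n of the
   mathematical text are numbered 0,...,n-1. *)

definition cartesian_power :: "'a set \<Rightarrow> nat \<Rightarrow> (nat \<Rightarrow> 'a) set" where
  "cartesian_power S n = ({..<n} \<rightarrow>\<^sub>E S)"

definition measure_power :: "'a measure \<Rightarrow> nat \<Rightarrow> (nat \<Rightarrow> 'a) measure" where
  "measure_power \<mu> n = PiM {..<n} (\<lambda>_. \<mu>)"

(* The result of deleting coordinate i lies again in a power of S: beyond the last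
   coordinate a point takes the value undefined, and shifting keeps it there. *)
definition delete_coord :: "nat \<Rightarrow> (nat \<Rightarrow> 'a) \<Rightarrow> nat \<Rightarrow> 'a" where
  "delete_coord i x = (\<lambda>j. if j < i then x j else x (Suc j))"

definition hamming_dist :: "nat \<Rightarrow> (nat \<Rightarrow> 'a) \<Rightarrow> (nat \<Rightarrow> 'a) \<Rightarrow> real" where
  "hamming_dist n x y = real (card {i \<in> {..<n}. x i \<noteq> y i})"

(* The diameter may be infinite, hence the extended values. *)
definition diam :: "'b set \<Rightarrow> ('b \<Rightarrow> 'b \<Rightarrow> real) \<Rightarrow> ennreal" where
  "diam X \<rho> = (SUP x\<in>X. SUP y\<in>X. ennreal (\<rho> x y))"

definition Lip :: "'b set \<Rightarrow> ('b \<Rightarrow> 'b \<Rightarrow> real) \<Rightarrow> ('b \<Rightarrow> real) set" where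
  "Lip X \<rho> = {g. (\<forall>x\<in>X. 0 \<le> g x \<and> ennreal (g x) \<le> diam X \<rho>) \<and>
                (\<forall>x\<in>X. \<forall>y\<in>X. \<bar>g x - g y\<bar> \<le> \<rho> x y)}"

(* case_nat a y is the point (a, y_0, y_1, ...). *)
definition integrate_first :: "'a measure \<Rightarrow> ((nat \<Rightarrow> 'a) \<Rightarrow> real) \<Rightarrow> (nat \<Rightarrow> 'a) \<Rightarrow> real" where
  "integrate_first \<mu> f = (\<lambda>y. \<integral>a. f (case_nat a y) \<partial>\<mu>)"

primrec Psi :: "'a measure \<Rightarrow> nat \<Rightarrow> ((nat \<Rightarrow> 'a) \<Rightarrow> real) \<Rightarrow> real" where
  "Psi \<mu> 0 f = 0"
| "Psi \<mu> (Suc n) f =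
     (\<integral>x. max (f x) 0 \<partial>measure_power \<mu> (Suc n)) + Psi \<mu> n (integrate_first \<mu> f)"

definition metric_borel_sets :: "'b set \<Rightarrow> ('b \<Rightarrow> 'b \<Rightarrow> real) \<Rightarrow> 'b set set" where
  "metric_borel_sets X \<rho> = sigma_sets X {U. openin (Metric_space.mtopology X \<rho>) U}"

(* In the second condition the product formula is required explicitly, because PiM
   satisfies it in general only for sigma-finite \<mu>.
   In the third condition, functions in Lip are continuous, hence measurable by the second
   condition. If the diameter is infinite, f g need not be integrable; its Bochner integral
   is then 0, which does not affect the supremum, as 0 is in Lip. *)
definition Psi_dominated ::
  "'a set \<Rightarrow> (nat \<Rightarrow> (nat \<Rightarrow> 'a) \<Rightarrow> (nat \<Rightarrow> 'a) \<Rightarrow> real) \<Rightarrow> 'a measure \<Rightarrow> bool" where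
  "Psi_dominated S \<rho> \<mu> \<longleftrightarrow>
     space \<mu> = S \<and>
     (\<forall>n\<ge>1. Metric_space (cartesian_power S n) (\<rho> n)) \<and>
     (\<forall>n\<ge>2. \<forall>i<n. \<forall>x\<in>cartesian_power S n. \<forall>y\<in>cartesian_power S n.
        x i = y i \<longrightarrow> \<rho> n x y = \<rho> (n - 1) (delete_coord i x) (delete_coord i y)) \<and>
     (\<forall>n\<ge>1. sets (measure_power \<mu> n) = metric_borel_sets (cartesian_power S n) (\<rho> n) \<and>
        (\<forall>A. (\<forall>i<n. A i \<in> sets \<mu>) \<longrightarrow>
           emeasure (measure_power \<mu> n) (\<Pi>\<^sub>E i\<in>{..<n}. A i) = (\<Prod>i<n. emeasure \<mu> (A i)))) \<and>
     (\<forall>n\<ge>1. \<forall>f. integrable (measure_power \<mu> n) f \<longrightarrow>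
        (SUP g\<in>Lip (cartesian_power S n) (\<rho> n).
           ereal (\<integral>x. f x * g x \<partial>measure_power \<mu> n)) \<le> ereal (Psi \<mu> n f))"

end

theory Submission
  imports Defs
begin

text \<open>The domination inequality \<open>\<integral> f g \<le> \<Psi>\<^sub>n(f)\<close> unfolds along the recursion for
  \<open>\<Psi>\<close> once a function \<open>g\<close> that is Hamming-1-Lipschitz with values in \<open>[0, n]\<close> is split as
  \<open>g(a, y) = r(a, y) + h(y)\<close>, where \<open>0 \<le> r \<le> 1\<close> and \<open>h\<close> is 1-Lipschitz with values in \<open>[0, n - 1]\<close>: then
  \<open>\<integral> f r \<le> \<integral> (f)\<^sub>+\<close>, and by Fubini \<open>\<integral> f h = \<integral> (\<pi> f) h\<close>, which induction bounds by
  \<open>\<Psi>\<^sub>n\<^sub>-\<^sub>1(\<pi> f)\<close>. The choice \<open>h(y) = min (inf\<^sub>a g(a, y)) (n - 1)\<close> works. Changing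
  the first coordinate moves a point by at most 1, so \<open>g\<close> exceeds its infimum over \<open>a\<close> by at most 1;
  it exceeds \<open>n - 1\<close> by at most 1 because \<open>g \<le> n\<close>. This is \<open>first_coord_split\<close>, and
  \<open>integral_le_Psi\<close> is the induction.

  The remaining conditions hold since all the measures involved are counting measures on countable
  sets, and the Hamming metric induces the discrete topology.\<close>

section \<open>The Hamming metric\<close>

lemma hamming_dist_sum: "hamming_dist n x y = (\<Sum>i<n. of_bool (x i \<noteq> y i))"
  by (simp add: hamming_dist_def sum.If_cases of_bool_def Int_def)

lemma hamming_dist_case_nat:
  "hamming_dist (Suc n) (case_nat a y) (case_nat b z) = of_bool (a \<noteq> b) + hamming_dist n y z"
  by (simp add: hamming_dist_sum sum.lessThan_Suc_shift del: sum.lessThan_Suc)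

lemma hamming_dist_le: "hamming_dist n x y \<le> real n"
proof -
  have "(\<Sum>i<n. of_bool (x i \<noteq> y i)) \<le> (\<Sum>i<n. 1 :: real)"
    by (intro sum_mono) auto
  then show ?thesis by (simp add: hamming_dist_sum)
qed

lemma Metric_space_hamming: "Metric_space (cartesian_power S n) (hamming_dist n)"
proof
  fix x y :: "nat \<Rightarrow> 'a"
  show "0 \<le> hamming_dist n x y"
    by (simp add: hamming_dist_def)
  show "hamming_dist n x y = hamming_dist n y x"
    by (simp add: hamming_dist_def eq_commute)
next
  fix x y :: "nat \<Rightarrow> 'a"
  assume "x \<in> cartesian_power S n" "y \<in> cartesian_power S n"
  then show "hamming_dist n x y = 0 \<longleftrightarrow> x = y"
    by (auto simp: hamming_dist_def cartesian_power_def intro: PiE_ext)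
next
  fix x y z :: "nat \<Rightarrow> 'a"
  have "(\<Sum>i<n. of_bool (x i \<noteq> z i)) \<le> (\<Sum>i<n. of_bool (x i \<noteq> y i) + of_bool (y i \<noteq> z i) :: real)"
    by (intro sum_mono) auto
  then show "hamming_dist n x z \<le> hamming_dist n x y + hamming_dist n y z"
    by (simp add: hamming_dist_sum sum.distrib)
qed

lemma hamming_dist_delete_coord:
  assumes "i < n" "x i = y i"
  shows "hamming_dist n x y = hamming_dist (n - 1) (delete_coord i x) (delete_coord i y)"
proof -
  have "(\<Sum>j<n. of_bool (x j \<noteq> y j)) = (\<Sum>j\<in>{..<n} - {i}. of_bool (x j \<noteq> y j) :: real)"
    using assms by (intro sum.mono_neutral_right) auto
  also have "\<dots> = (\<Sum>j<n - 1. of_bool (delete_coord i x j \<noteq> delete_coord i y j))"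
    by (rule sum.reindex_bij_witness
        [where i = "\<lambda>j. if j < i then j else Suc j" and j = "\<lambda>j. if j < i then j else j - 1"])
      (use assms in \<open>auto simp: delete_coord_def split: if_splits\<close>)
  finally show ?thesis by (simp add: hamming_dist_sum)
qed

lemma metric_borel_sets_hamming:
  "metric_borel_sets (cartesian_power S n) (hamming_dist n) = Pow (cartesian_power S n)"
proof -
  interpret Metric_space "cartesian_power S n" "hamming_dist n"
    by (rule Metric_space_hamming)
  \<comment> \<open>Distances are integers, so balls of radius 1 are singletons.\<close>
  have "mball x 1 \<subseteq> {x}" for x
  proof
    fix y assume "y \<in> mball x 1"
    then have "x \<in> cartesian_power S n" "y \<in> cartesian_power S n" "hamming_dist n x y = 0"
      by (auto simp: hamming_dist_def)
    then show "y \<in> {x}"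
      by simp
  qed
  then have "openin mtopology U \<longleftrightarrow> U \<subseteq> cartesian_power S n" for U
    unfolding openin_mtopology by (meson empty_subsetI insert_subset order_trans zero_less_one)
  then have "{U. openin mtopology U} = Pow (cartesian_power S n)"
    by auto
  then show ?thesis
    unfolding metric_borel_sets_def
    by (metis sigma_algebra.sigma_sets_eq sigma_algebra_Pow)
qed

lemma Lip_hamming_bounded:
  assumes "g \<in> Lip (cartesian_power S n) (hamming_dist n)" "x \<in> cartesian_power S n"
  shows "g x \<le> real n"
proof -
  have "diam (cartesian_power S n) (hamming_dist n) \<le> ennreal (real n)"
    unfolding diam_def by (intro SUP_least ennreal_leI hamming_dist_le)
  with assms have "ennreal (g x) \<le> ennreal (real n)"
    unfolding Lip_def by (blast intro: order_trans)
  then show ?thesis by simp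
qed

section \<open>Powers of counting measure\<close>

lemma measure_power_count_space:
  "measure_power (count_space (UNIV :: 'a :: countable set)) n = count_space (cartesian_power UNIV n)"
  unfolding measure_power_def cartesian_power_def by (rule count_space_PiM_finite) auto

lemma countable_cartesian_power: "countable (cartesian_power (UNIV :: 'a :: countable set) n)"
  unfolding cartesian_power_def by (rule countable_PiE) auto

lemma delete_coord_case_nat [simp]: "delete_coord 0 (case_nat a y) = y"
  by (simp add: delete_coord_def)

lemma case_nat_in_cartesian_power:
  "y \<in> cartesian_power UNIV n \<Longrightarrow> case_nat a y \<in> cartesian_power UNIV (Suc n)"
  by (auto simp: cartesian_power_def PiE_def extensional_def split: nat.split)

lemma delete_first_in_cartesian_power:
  "x \<in> cartesian_power UNIV (Suc n) \<Longrightarrow> delete_coord 0 x \<in> cartesian_power UNIV n"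
  by (auto simp: cartesian_power_def PiE_def extensional_def delete_coord_def)

lemma case_nat_delete_coord: "case_nat (x 0) (delete_coord 0 x) = x"
  by (auto simp: delete_coord_def split: nat.split)

lemma bij_betw_case_nat:
  "bij_betw (\<lambda>(y, a). case_nat a y) (cartesian_power UNIV n \<times> UNIV) (cartesian_power UNIV (Suc n))"
  by (rule bij_betwI[where g = "\<lambda>x. (delete_coord 0 x, x 0)"])
    (auto simp: case_nat_in_cartesian_power delete_first_in_cartesian_power case_nat_delete_coord)

lemma
  fixes f :: "(nat \<Rightarrow> 'a :: countable) \<Rightarrow> real"
  assumes f: "integrable (count_space (cartesian_power UNIV (Suc n))) f"
  shows integrable_integrate_first:
      "integrable (count_space (cartesian_power UNIV n)) (integrate_first (count_space UNIV) f)"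
    and integral_integrate_first:
      "(\<integral>y. integrate_first (count_space UNIV) f y \<partial>count_space (cartesian_power UNIV n)) =
       (\<integral>x. f x \<partial>count_space (cartesian_power UNIV (Suc n)))"
proof -
  let ?P = "cartesian_power (UNIV :: 'a set) n"
  interpret pair_sigma_finite "count_space ?P" "count_space (UNIV :: 'a set)"
    by (intro pair_sigma_finite.intro sigma_finite_measure_count_space_countable
        countable_cartesian_power) auto
  let ?F = "\<lambda>p. f ((\<lambda>(y, a). case_nat a y) p)"
  have pair: "count_space ?P \<Otimes>\<^sub>M count_space UNIV = count_space (?P \<times> (UNIV :: 'a set))"
    by (intro pair_measure_countable countable_cartesian_power) auto
  have F: "integrable (count_space ?P \<Otimes>\<^sub>M count_space UNIV) ?F"
    unfolding pair using f integrable_bij_count_space[OF bij_betw_case_nat] by blast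
  show "integrable (count_space ?P) (integrate_first (count_space UNIV) f)"
    using integrable_fst'[OF F] by (simp add: integrate_first_def)
  show "(\<integral>y. integrate_first (count_space UNIV) f y \<partial>count_space ?P) =
      (\<integral>x. f x \<partial>count_space (cartesian_power UNIV (Suc n)))"
    using integral_fst'[OF F] integral_bij_count_space[OF bij_betw_case_nat, of n f]
    by (simp add: integrate_first_def pair)
qed

section \<open>The domination inequality\<close>

lemma integrable_mult_bounded_count_space:
  fixes f g :: "'a \<Rightarrow> real"
  assumes f: "integrable (count_space A) f" and g: "\<And>x. x \<in> A \<Longrightarrow> \<bar>g x\<bar> \<le> B"
  shows "integrable (count_space A) (\<lambda>x. f x * g x)"
proof (rule Bochner_Integration.integrable_bound)
  show "integrable (count_space A) (\<lambda>x. B * f x)"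
    using f by simp
  show "AE x in count_space A. norm (f x * g x) \<le> norm (B * f x)"
  proof (rule AE_I2)
    fix x assume "x \<in> space (count_space A)"
    then have "\<bar>g x\<bar> \<le> \<bar>B\<bar>" using g[of x] by simp
    then show "norm (f x * g x) \<le> norm (B * f x)"
      by (metis abs_ge_zero abs_mult mult.commute mult_left_mono real_norm_def)
  qed
qed simp

text \<open>Truncating the infimum at \<open>n\<close> is what keeps \<open>h\<close> within the range needed for the next
  induction step.\<close>

lemma first_coord_split:
  fixes g :: "(nat \<Rightarrow> 'a) \<Rightarrow> real"
  assumes g0: "\<And>x. x \<in> cartesian_power UNIV (Suc n) \<Longrightarrow> 0 \<le> g x"
    and gn: "\<And>x. x \<in> cartesian_power UNIV (Suc n) \<Longrightarrow> g x \<le> real (Suc n)"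
    and lip: "\<And>x y. x \<in> cartesian_power UNIV (Suc n) \<Longrightarrow> y \<in> cartesian_power UNIV (Suc n) \<Longrightarrow>
      \<bar>g x - g y\<bar> \<le> hamming_dist (Suc n) x y"
  obtains h where
    "\<And>y. y \<in> cartesian_power UNIV n \<Longrightarrow> 0 \<le> h y \<and> h y \<le> real n"
    "\<And>y z. y \<in> cartesian_power UNIV n \<Longrightarrow> z \<in> cartesian_power UNIV n \<Longrightarrow>
      \<bar>h y - h z\<bar> \<le> hamming_dist n y z"
    "\<And>x. x \<in> cartesian_power UNIV (Suc n) \<Longrightarrow>
      0 \<le> g x - h (delete_coord 0 x) \<and> g x - h (delete_coord 0 x) \<le> 1"
proof
  define m where "m y = (INF a. g (case_nat a y))" for y
  define h where "h y = min (m y) (real n)" for y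
  note cn = case_nat_in_cartesian_power
  have m_le: "m y \<le> g (case_nat a y)" if "y \<in> cartesian_power UNIV n" for y a
    unfolding m_def by (rule cINF_lower) (auto intro!: bdd_belowI[of _ 0] g0 cn that)
  have le_m: "c \<le> m y" if "\<And>a. c \<le> g (case_nat a y)" for c y
    unfolding m_def by (rule cINF_greatest) (auto intro: that)
  show "0 \<le> h y \<and> h y \<le> real n" if "y \<in> cartesian_power UNIV n" for y
    using le_m[of 0 y] g0 cn[OF that] by (auto simp: h_def)
  have m_lip: "m y - hamming_dist n y z \<le> m z"
    if "y \<in> cartesian_power UNIV n" "z \<in> cartesian_power UNIV n" for y z
  proof (rule le_m)
    fix a
    show "m y - hamming_dist n y z \<le> g (case_nat a z)"
      using m_le[OF that(1), of a] lip[OF cn[OF that(1), of a] cn[OF that(2), of a]]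
      by (simp add: hamming_dist_case_nat)
  qed
  show "\<bar>h y - h z\<bar> \<le> hamming_dist n y z"
    if "y \<in> cartesian_power UNIV n" "z \<in> cartesian_power UNIV n" for y z
  proof -
    have "0 \<le> hamming_dist n y z" "hamming_dist n z y = hamming_dist n y z"
      by (simp_all add: hamming_dist_def eq_commute)
    then show ?thesis
      using m_lip[OF that] m_lip[OF that(2,1)] by (auto simp: h_def min_def)
  qed
  show "0 \<le> g x - h (delete_coord 0 x) \<and> g x - h (delete_coord 0 x) \<le> 1"
    if x: "x \<in> cartesian_power UNIV (Suc n)" for x
  proof -
    define y where "y = delete_coord 0 x"
    have y: "y \<in> cartesian_power UNIV n" and x_eq: "case_nat (x 0) y = x"
      using x by (simp_all add: y_def delete_first_in_cartesian_power case_nat_delete_coord)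
    have "g x - 1 \<le> m y"
    proof (rule le_m)
      fix a
      have "hamming_dist (Suc n) x (case_nat a y) \<le> 1"
        using hamming_dist_case_nat[of n "x 0" y a y] x_eq by (simp add: hamming_dist_def)
      then show "g x - 1 \<le> g (case_nat a y)"
        using lip[OF x cn[OF y, of a]] by simp
    qed
    then show ?thesis
      using m_le[OF y, of "x 0"] x_eq gn[OF x] by (auto simp: h_def y_def min_def)
  qed
qed

lemma integral_le_Psi:
  fixes f g :: "(nat \<Rightarrow> 'a :: countable) \<Rightarrow> real"
  assumes "integrable (count_space (cartesian_power UNIV n)) f"
    and "\<And>x. x \<in> cartesian_power UNIV n \<Longrightarrow> 0 \<le> g x"
    and "\<And>x. x \<in> cartesian_power UNIV n \<Longrightarrow> g x \<le> real n"
    and "\<And>x y. x \<in> cartesian_power UNIV n \<Longrightarrow> y \<in> cartesian_power UNIV n \<Longrightarrow>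
      \<bar>g x - g y\<bar> \<le> hamming_dist n x y"
  shows "(\<integral>x. f x * g x \<partial>count_space (cartesian_power UNIV n)) \<le> Psi (count_space UNIV) n f"
  using assms
proof (induction n arbitrary: f g)
  case 0
  have "(\<integral>x. f x * g x \<partial>count_space (cartesian_power UNIV 0)) =
      (\<integral>x. 0 \<partial>count_space (cartesian_power (UNIV :: 'a set) 0))"
    using "0.prems"(2,3) by (intro Bochner_Integration.integral_cong) force+
  then show ?case by simp
next
  case (Suc n)
  let ?M = "count_space (cartesian_power (UNIV :: 'a set) (Suc n))"
  let ?N = "count_space (cartesian_power (UNIV :: 'a set) n)"
  let ?pi = "integrate_first (count_space (UNIV :: 'a set))"
  obtain h where h: "\<And>y. y \<in> cartesian_power UNIV n \<Longrightarrow> 0 \<le> h y \<and> h y \<le> real n"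
    and h_lip: "\<And>y z. y \<in> cartesian_power UNIV n \<Longrightarrow> z \<in> cartesian_power UNIV n \<Longrightarrow>
      \<bar>h y - h z\<bar> \<le> hamming_dist n y z"
    and r: "\<And>x. x \<in> cartesian_power UNIV (Suc n) \<Longrightarrow>
      0 \<le> g x - h (delete_coord 0 x) \<and> g x - h (delete_coord 0 x) \<le> 1"
    using first_coord_split[OF Suc.prems(2-4)] by metis
  define t where "t x = h (delete_coord 0 x)" for x
  have int_t: "integrable ?M (\<lambda>x. f x * t x)"
    using h[OF delete_first_in_cartesian_power]
    by (intro integrable_mult_bounded_count_space[OF Suc.prems(1), of _ "real n"])
      (auto simp: t_def)
  have int_r: "integrable ?M (\<lambda>x. f x * (g x - t x))"
    using r by (intro integrable_mult_bounded_count_space[OF Suc.prems(1), of _ 1])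
      (auto simp: t_def)
  have "(\<integral>x. f x * (g x - t x) \<partial>?M) \<le> (\<integral>x. max (f x) 0 \<partial>?M)"
  proof (rule integral_mono[OF int_r])
    show "integrable ?M (\<lambda>x. max (f x) 0)"
      using Suc.prems(1) by simp
    fix x assume "x \<in> space ?M"
    then have "0 \<le> g x - t x" "g x - t x \<le> 1"
      using r by (auto simp: t_def)
    then have "f x * (g x - t x) \<le> max (f x) 0 * (g x - t x)" "max (f x) 0 * (g x - t x) \<le> max (f x) 0"
      by (auto intro: mult_right_mono mult_left_le)
    then show "f x * (g x - t x) \<le> max (f x) 0"
      by linarith
  qed
  moreover have "(\<integral>x. f x * t x \<partial>?M) \<le> Psi (count_space UNIV) n (?pi f)"
  proof -
    have "(\<integral>x. f x * t x \<partial>?M) = (\<integral>y. ?pi (\<lambda>x. f x * t x) y \<partial>?N)"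
      by (rule integral_integrate_first[OF int_t, symmetric])
    also have "\<dots> = (\<integral>y. ?pi f y * h y \<partial>?N)"
      by (simp add: integrate_first_def t_def)
    also have "\<dots> \<le> Psi (count_space UNIV) n (?pi f)"
      using h h_lip by (intro Suc.IH integrable_integrate_first Suc.prems(1)) auto
    finally show ?thesis .
  qed
  moreover have "(\<integral>x. f x * g x \<partial>?M) = (\<integral>x. f x * (g x - t x) \<partial>?M) + (\<integral>x. f x * t x \<partial>?M)"
    by (subst Bochner_Integration.integral_add[OF int_r int_t, symmetric])
      (simp add: algebra_simps)
  ultimately show ?case
    by (simp add: measure_power_count_space)
qed

theorem mainTheorem3:
  shows "Psi_dominated (UNIV :: nat set) hamming_dist (count_space (UNIV :: nat set))"
  unfolding Psi_dominated_def
proof (intro conjI allI ballI impI)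
  show "space (count_space UNIV) = (UNIV :: nat set)"
    by simp
  show "Metric_space (cartesian_power (UNIV :: nat set) n) (hamming_dist n)" for n
    by (rule Metric_space_hamming)
  show "hamming_dist n x y = hamming_dist (n - 1) (delete_coord i x) (delete_coord i y)"
    if "i < n" "x i = y i" for n i and x y :: "nat \<Rightarrow> nat"
    using that by (rule hamming_dist_delete_coord)
  show "sets (measure_power (count_space (UNIV :: nat set)) n) =
      metric_borel_sets (cartesian_power UNIV n) (hamming_dist n)" for n
    by (simp add: measure_power_count_space metric_borel_sets_hamming)
  show "emeasure (measure_power (count_space (UNIV :: nat set)) n) (\<Pi>\<^sub>E i\<in>{..<n}. A i) =
      (\<Prod>i<n. emeasure (count_space UNIV) (A i))" for n and A :: "nat \<Rightarrow> nat set"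
  proof -
    interpret product_sigma_finite "\<lambda>_ :: nat. count_space (UNIV :: nat set)"
      by (simp add: product_sigma_finite_def sigma_finite_measure_count_space)
    show ?thesis
      unfolding measure_power_def by (rule emeasure_PiM) auto
  qed
  show "(SUP g\<in>Lip (cartesian_power UNIV n) (hamming_dist n).
        ereal (\<integral>x. f x * g x \<partial>measure_power (count_space UNIV) n))
      \<le> ereal (Psi (count_space UNIV) n f)"
    if f: "integrable (measure_power (count_space (UNIV :: nat set)) n) f" for n f
  proof (rule SUP_least)
    fix g :: "(nat \<Rightarrow> nat) \<Rightarrow> real"
    assume g: "g \<in> Lip (cartesian_power UNIV n) (hamming_dist n)"
    have "(\<integral>x. f x * g x \<partial>count_space (cartesian_power UNIV n)) \<le> Psi (count_space UNIV) n f"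
      using f g Lip_hamming_bounded[OF g]
      by (intro integral_le_Psi) (auto simp: measure_power_count_space Lip_def)
    then show "ereal (\<integral>x. f x * g x \<partial>measure_power (count_space UNIV) n)
        \<le> ereal (Psi (count_space UNIV) n f)"
      by (simp add: measure_power_count_space)
  qed
qed

end
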